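(* For any two probability measures $P,Q$ on $\mathbb{R}^d$, and any minimizers $\hat K_P$ and $\hat K_Q$ of the problem $$\min_{K}\ \mathbb{E}_{R}[\|\mathbf{x}\|_K]\quad\text{s.t.}\quad K\ \text{a star body in }\mathbb{R}^d,\ \mathrm{vol}(K)=1,\ K\ \text{convex},$$ with $R=P$ and $R=Q$ respectively, we have $$\mathbb{E}_Q[\|\mathbf{x}\|_{\hat K_P}]\ \le\ \inf_{K\ \mathrm{convex},\ \mathrm{vol}(K)=1}\mathbb{E}_Q[\|\mathbf{x}\|_K]+\big(\mathrm{Lip}(\hat K_P)+\mathrm{Lip}(\hat K_Q)\big)\,W_1(P,Q),$$ where the infimum is over convex star bodies $K\subset\mathbb{R}^d$ of unit volume.
   Context: A star body in $\mathbb{R}^d$ is a compact set $K$ with nonempty interior such that $[\mathbf{0},\mathbf{y}]\subset K$ for every $\mathbf{y}\in K$ and, for every $\mathbf{x}\ne \mathbf{0}$, the ray $\{\lambda\mathbf{x}:\lambda>0\}$ meets the boundary of $K$ exactly once (equivalently, its radial function is positive and continuous on the unit sphere). The gauge of $K$ is $\|\mathbf{x}\|_K=\inf\{\lambda\ge 0:\mathbf{x}\in\lambda K\}$. The kernel of $K$ is $\mathrm{ker}(K)=\{\mathbf{x}\in K:[\mathbf{x},\mathbf{y}]\subset K\ \forall\,\mathbf{y}\in K\}$ (equal to $K$ when $K$ is convex), and $\mathrm{Lip}(K):=\inf\{1/r:r>0,\ rB^d\subseteq\mathrm{ker}(K)\}$ with $B^d$ the closed Euclidean unit ball; this is the Lipschitz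 constant of $\|\cdot\|_K$ with respect to the Euclidean norm. $W_1(P,Q)=\inf_{\beta\in\Gamma(P,Q)}\mathbb{E}_{(X,Y)\sim\beta}\|X-Y\|_2$ with $\Gamma(P,Q)$ the set of couplings of $P$ and $Q$. *)

theory Defs
  imports "HOL-Probability.Probability"
begin

definition star_body :: "'a::euclidean_space set \<Rightarrow> bool" where
  "star_body K \<longleftrightarrow>
     compact K \<and> interior K \<noteq> {} \<and>
     (\<forall>y\<in>K. closed_segment 0 y \<subseteq> K) \<and>
     (\<forall>x. x \<noteq> 0 \<longrightarrow> (\<exists>!z. z \<in> {c *\<^sub>R x | c. c > 0} \<inter> frontier K))"

text \<open>For a star body the set below is nonempty and bounded below by \<open>0\<close>, so the
  infimum over the reals is the genuine one.\<close>

definition body_gauge :: "'a::euclidean_space set \<Rightarrow> 'a \<Rightarrow> real" where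
  "body_gauge K x = Inf {c. c \<ge> 0 \<and> x \<in> (\<lambda>y. c *\<^sub>R y) ` K}"

definition star_kernel :: "'a::euclidean_space set \<Rightarrow> 'a set" where
  "star_kernel K = {x \<in> K. \<forall>y\<in>K. closed_segment x y \<subseteq> K}"

text \<open>The infimum is taken in the extended reals: it is \<open>\<infinity>\<close> when the kernel contains no
  ball around the origin.\<close>

definition Lip :: "'a::euclidean_space set \<Rightarrow> ennreal" where
  "Lip K = (INF r\<in>{r. r > 0 \<and> cball 0 r \<subseteq> star_kernel K}. ennreal (1 / r))"

definition couplings :: "'a measure \<Rightarrow> 'b measure \<Rightarrow> ('a \<times> 'b) measure set" where
  "couplings P Q = {\<beta>. prob_space \<beta> \<and> sets \<beta> = sets (P \<Otimes>\<^sub>M Q) \<and>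
                        distr \<beta> P fst = P \<and> distr \<beta> Q snd = Q}"

definition W1 :: "'a::euclidean_space measure \<Rightarrow> 'a measure \<Rightarrow> ennreal" where
  "W1 P Q = (INF \<beta>\<in>couplings P Q. \<integral>\<^sup>+ z. ennreal (norm (fst z - snd z)) \<partial>\<beta>)"

text \<open>No moment condition is imposed on the distributions, so the expectation of the
  (nonnegative) gauge may be \<open>\<infinity>\<close>.\<close>

definition expected_gauge :: "'a::euclidean_space measure \<Rightarrow> 'a set \<Rightarrow> ennreal" where
  "expected_gauge R K = (\<integral>\<^sup>+ x. ennreal (body_gauge K x) \<partial>R)"

definition unit_volume_convex_body :: "'a::euclidean_space set \<Rightarrow> bool" where
  "unit_volume_convex_body K \<longleftrightarrow> star_body K \<and> emeasure lborel K = 1 \<and> convex K"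

end

theory Submission imports Defs begin

text \<open>A gauge is \<open>Lip\<close>-Lipschitz, so integrating against a coupling \<open>\<beta>\<close> of \<open>P\<close> and \<open>Q\<close>
  changes the expected gauge by at most \<open>Lip\<close> times the cost of \<open>\<beta>\<close> when \<open>P\<close> is exchanged
  for \<open>Q\<close>. The bound follows by passing from \<open>Q\<close> to \<open>P\<close> with \<open>K\<^sub>P\<close>, replacing \<open>K\<^sub>P\<close>
  by \<open>K\<^sub>Q\<close> (optimality under \<open>P\<close>), returning to \<open>Q\<close> with \<open>K\<^sub>Q\<close>, and using the optimality
  of \<open>K\<^sub>Q\<close> under \<open>Q\<close>.\<close>

text \<open>Dividing by \<open>c\<close> turns the bound into a lower bound for every
  \<open>f i\<close>, hence for their infimum. If \<open>c = 0\<close> no division is possible, and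
  one index is needed to force \<open>a = 0\<close>. Used for the infimum over radii in
  \<open>Lip\<close> and over couplings in \<open>W1\<close>.\<close>

lemma ennreal_le_mult_INF:
  fixes a c :: ennreal
  assumes "\<And>i. i \<in> I \<Longrightarrow> a \<le> c * f i" "c < \<top>" "c = 0 \<Longrightarrow> I \<noteq> {}"
  shows "a \<le> c * (INF i\<in>I. f i)"
proof (cases "c = 0")
  case True
  then show ?thesis using assms by fastforce
next
  case False
  have "a / c \<le> f i" if "i \<in> I" for i
    using assms(1)[OF that] assms(2) False
    by (metis divide_right_mono_ennreal ennreal_mult_divide_eq mult.commute order_less_irrefl)
  then have "c * (a / c) \<le> c * (INF i\<in>I. f i)"
    by (intro mult_left_mono INF_greatest) auto
  then show ?thesis
    using False assms(2) by (simp add: ennreal_times_divide mult.commute[of c a] ennreal_mult_divide_eq)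
qed

lemma star_kernel_convex: "convex K \<Longrightarrow> star_kernel K = K"
  by (auto simp: star_kernel_def convex_contains_segment)

text \<open>Otherwise a hyperplane through the origin would have \<open>K\<close> on one side, and
  the ray on the other side, along the opposite normal, could not meet the frontier.\<close>

lemma zero_in_interior_convex_star_body:
  fixes K :: "'a::euclidean_space set"
  assumes "star_body K" "convex K"
  shows "0 \<in> interior K"
proof (rule ccontr)
  assume "0 \<notin> interior K"
  moreover have ne: "interior K \<noteq> {}" and cl: "closed K"
    using assms(1) by (auto simp: star_body_def compact_imp_closed)
  ultimately obtain a where a: "a \<noteq> 0" "\<And>x. x \<in> interior K \<Longrightarrow> 0 \<le> a \<bullet> x"
    using separating_hyperplane_set_0[of "interior K"] assms(2) by (auto simp: convex_interior)
  \<comment> \<open>A closed convex set with nonempty interior is the closure of that interior, so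
    the half-space inequality passes from \<open>interior K\<close> to all of
    \<open>K\<close>.\<close>
  have "K \<subseteq> closure (interior K)"
    using ne cl assms(2) by (simp add: convex_closure_interior)
  also have "\<dots> \<subseteq> {x. 0 \<le> a \<bullet> x}"
    using a(2) by (intro closure_minimal subsetI CollectI closed_halfspace_component_ge closed_Collect_le continuous_intros)
  finally have K: "K \<subseteq> {x. 0 \<le> a \<bullet> x}" .
  have "\<forall>x. x \<noteq> 0 \<longrightarrow> (\<exists>!z. z \<in> {c *\<^sub>R x | c. c > 0} \<inter> frontier K)"
    using assms(1) unfolding star_body_def by (elim conjE)
  then have "- a \<noteq> 0 \<longrightarrow> (\<exists>!z. z \<in> {c *\<^sub>R (- a) | c. c > 0} \<inter> frontier K)"
    by (rule spec)
  then have "\<exists>!z. z \<in> {c *\<^sub>R (- a) | c. c > 0} \<inter> frontier K"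
    by (rule mp) (simp add: a(1))
  then obtain c where "c > 0" "c *\<^sub>R (- a) \<in> frontier K"
    by blast
  with K cl have "0 \<le> a \<bullet> (c *\<^sub>R (- a))"
    using frontier_subset_closed by blast
  with \<open>c > 0\<close> a(1) show False
    by (simp add: mult_le_0_iff) (metis inner_gt_zero_iff not_le)
qed

lemma Lip_convex_star_body_finite:
  assumes "star_body K" "convex K"
  shows "Lip K < \<top>"
proof -
  obtain r where "r > 0" "cball 0 r \<subseteq> K"
    using zero_in_interior_convex_star_body[OF assms] by (auto simp: mem_interior_cball)
  then have "Lip K \<le> ennreal (1 / r)"
    unfolding Lip_def by (intro INF_lower) (simp add: star_kernel_convex assms(2))
  then show ?thesis
    using le_less_trans by fastforce
qed

text \<open>Up to the factor \<open>c + d\<close>, the sum is a point of the segment from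
  \<open>b\<close> to \<open>k\<close>, which stays in \<open>K\<close> because \<open>b\<close> is
  in the kernel. This replaces convexity in the subadditivity of the gauge.\<close>

lemma scaleR_star_kernel_add:
  assumes "k \<in> K" "b \<in> star_kernel K" "0 \<le> c" "0 \<le> d"
  shows "c *\<^sub>R k + d *\<^sub>R b \<in> (\<lambda>y. (c + d) *\<^sub>R y) ` K"
proof (cases "c + d = 0")
  case True
  then have "c = 0" "d = 0" using assms by auto
  then show ?thesis using assms(1) by force
next
  case False
  then have pos: "c + d > 0" using assms by simp
  define u where "u = c / (c + d)"
  have u: "0 \<le> u" "u \<le> 1" "(c + d) * u = c" "(c + d) * (1 - u) = d"
    using assms pos by (auto simp: u_def field_simps)
  have "(1 - u) *\<^sub>R b + u *\<^sub>R k \<in> closed_segment b k"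
    using u by (auto simp: closed_segment_def)
  then have "(1 - u) *\<^sub>R b + u *\<^sub>R k \<in> K"
    using assms by (auto simp: star_kernel_def)
  moreover have "(c + d) *\<^sub>R ((1 - u) *\<^sub>R b + u *\<^sub>R k) = c *\<^sub>R k + d *\<^sub>R b"
    using u by (simp only: scaleR_add_right scaleR_scaleR) simp
  ultimately show ?thesis
    by (metis (no_types, lifting) image_eqI)
qed

text \<open>Write x = y + (x - y): if y lies in \<open>c\<close> times \<open>K\<close>, then x - y
  lies in \<open>norm (x - y) / r\<close> times the kernel, so the sum of the two factors is
  admissible for x.\<close>

lemma body_gauge_lipschitz:
  fixes K :: "'a::euclidean_space set"
  assumes r: "r > 0" "cball 0 r \<subseteq> star_kernel K"
  shows "body_gauge K x \<le> body_gauge K y + norm (x - y) / r"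
proof -
  let ?C = "\<lambda>x. {c. c \<ge> 0 \<and> x \<in> (\<lambda>y. c *\<^sub>R y) ` K}"
  have step: "c + norm (x - y) / r \<in> ?C x" if c: "c \<in> ?C y" for c x y
  proof -
    obtain k where k: "k \<in> K" "y = c *\<^sub>R k" "c \<ge> 0" using c by auto
    \<comment> \<open>The displacement rescaled to length \<open>r\<close>; it is 0 when x = y,
      since division by zero yields 0.\<close>
    let ?b = "(r / norm (x - y)) *\<^sub>R (x - y)"
    have "norm ?b \<le> r" using r by simp
    then have "?b \<in> star_kernel K" using r by (meson mem_cball_0 subsetD)
    then have mem: "c *\<^sub>R k + (norm (x - y) / r) *\<^sub>R ?b \<in> (\<lambda>z. (c + norm (x - y) / r) *\<^sub>R z) ` K"
      using k r(1) by (intro scaleR_star_kernel_add) auto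
    have "(norm (x - y) / r) *\<^sub>R ?b = x - y"
      using r(1) by (cases "x = y") simp_all
    then have eq: "c *\<^sub>R k + (norm (x - y) / r) *\<^sub>R ?b = x"
      unfolding k(2)[symmetric] by simp
    have "x \<in> (\<lambda>z. (c + norm (x - y) / r) *\<^sub>R z) ` K"
      using mem unfolding eq .
    then show ?thesis using k(3) r(1) by simp
  qed
  \<comment> \<open>The real \<open>Inf\<close> is meaningful only on a nonempty set: 0 is
    admissible at the origin, and \<open>step\<close> carries this to every point.\<close>
  have "0 \<in> star_kernel K" using r by (meson centre_in_cball less_imp_le subsetD)
  then have "0 \<in> K" by (simp add: star_kernel_def)
  then have "0 \<in> ?C 0" by force
  from step[OF this] have "?C y \<noteq> {}" by blast
  moreover have "body_gauge K x - norm (x - y) / r \<le> c" if "c \<in> ?C y" for c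
  proof -
    have "Inf (?C x) \<le> c + norm (x - y) / r"
      by (rule cInf_lower[OF step[OF that]]) (auto intro: bdd_belowI[of _ 0])
    then show ?thesis by (simp add: body_gauge_def)
  qed
  ultimately have "body_gauge K x - norm (x - y) / r \<le> Inf (?C y)"
    by (rule cInf_greatest)
  then show ?thesis by (simp add: body_gauge_def)
qed

text \<open>Takes the infimum over all admissible radii. The case x = y is split off because the
  factor \<open>norm (x - y)\<close> then vanishes while the set of radii may be empty.\<close>

lemma body_gauge_le_Lip:
  fixes K :: "'a::euclidean_space set"
  shows "ennreal (body_gauge K x) \<le> ennreal (body_gauge K y) + Lip K * ennreal (norm (x - y))"
proof (cases "x = y")
  case False
  have "ennreal (body_gauge K x) - ennreal (body_gauge K y) \<le> ennreal (norm (x - y)) * Lip K"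
    unfolding Lip_def
  proof (rule ennreal_le_mult_INF)
    fix r assume "r \<in> {r. r > 0 \<and> cball 0 r \<subseteq> star_kernel K}"
    then have r: "r > 0" "cball 0 r \<subseteq> star_kernel K" by auto
    let ?t = "norm (x - y) / r"
    have "ennreal (body_gauge K x) \<le> ennreal (body_gauge K y + ?t)"
      using body_gauge_lipschitz[OF r, of x y] by (rule ennreal_leI)
    \<comment> \<open>\<open>ennreal\<close> truncates negative reals to 0, so additivity is argued
      by the sign of the gauge value.\<close>
    also have "\<dots> \<le> ennreal (body_gauge K y) + ennreal ?t"
      using r(1) by (cases "0 \<le> body_gauge K y") (auto simp: ennreal_neg intro!: ennreal_leI)
    also have "ennreal ?t = ennreal (norm (x - y)) * ennreal (1 / r)"
      using r(1) by (simp flip: ennreal_mult)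
    finally show "ennreal (body_gauge K x) - ennreal (body_gauge K y)
        \<le> ennreal (norm (x - y)) * ennreal (1 / r)"
      by (simp add: ennreal_minus_le_iff)
  qed (use False in auto)
  then show ?thesis
    by (simp add: ennreal_minus_le_iff mult.commute)
qed simp

lemma borel_measurable_body_gauge:
  fixes K :: "'a::euclidean_space set"
  assumes "Lip K < \<top>"
  shows "body_gauge K \<in> borel_measurable borel"
proof -
  obtain r where r: "r > 0" "cball 0 r \<subseteq> star_kernel K"
    using assms by (force simp: Lip_def INF_less_iff)
  have "dist (body_gauge K x) (body_gauge K y) \<le> 1 / r * dist x y" for x y
    using body_gauge_lipschitz[OF r, of x y] body_gauge_lipschitz[OF r, of y x]
    by (auto simp: dist_norm norm_minus_commute abs_le_iff)
  then have "(1 / r)-lipschitz_on UNIV (body_gauge K)"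
    using r by (intro lipschitz_onI) auto
  then show ?thesis
    by (intro borel_measurable_continuous_onI lipschitz_on_continuous_on)
qed

text \<open>By the marginal conditions both expectations become integrals over the same \<beta>,
  where the pointwise Lipschitz bound can be integrated.\<close>

lemma expected_gauge_le_coupling:
  fixes K :: "'a::euclidean_space set"
  assumes P: "sets P = sets borel" and Q: "sets Q = sets borel"
    and \<beta>: "\<beta> \<in> couplings P Q" and K: "Lip K < \<top>"
  defines "D \<equiv> \<integral>\<^sup>+ z. ennreal (norm (fst z - snd z)) \<partial>\<beta>"
  shows "expected_gauge P K \<le> expected_gauge Q K + Lip K * D"
    and "expected_gauge Q K \<le> expected_gauge P K + Lip K * D"
proof -
  have [measurable_cong]: "sets \<beta> = sets (borel \<Otimes>\<^sub>M borel)"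
    using \<beta> sets_pair_measure_cong[OF P Q] by (simp add: couplings_def)
  have [measurable]: "body_gauge K \<in> borel_measurable borel"
    by (rule borel_measurable_body_gauge[OF K])
  have [measurable]: "fst \<in> measurable \<beta> P" "snd \<in> measurable \<beta> Q"
    by (simp_all add: measurable_cong_sets[OF refl P] measurable_cong_sets[OF refl Q])
  have dP: "P = distr \<beta> P fst" and dQ: "Q = distr \<beta> Q snd"
    using \<beta> by (auto simp: couplings_def)
  have mP: "(\<lambda>x. ennreal (body_gauge K x)) \<in> borel_measurable P"
    and mQ: "(\<lambda>x. ennreal (body_gauge K x)) \<in> borel_measurable Q"
    by (simp_all add: measurable_cong_sets[OF P refl] measurable_cong_sets[OF Q refl])
  have eP: "expected_gauge P K = (\<integral>\<^sup>+ z. ennreal (body_gauge K (fst z)) \<partial>\<beta>)"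
    unfolding expected_gauge_def by (subst dP, subst nn_integral_distr) (use mP in auto)
  have eQ: "expected_gauge Q K = (\<integral>\<^sup>+ z. ennreal (body_gauge K (snd z)) \<partial>\<beta>)"
    unfolding expected_gauge_def by (subst dQ, subst nn_integral_distr) (use mQ in auto)
  have "expected_gauge P K \<le> (\<integral>\<^sup>+ z. ennreal (body_gauge K (snd z)) 
      + Lip K * ennreal (norm (fst z - snd z)) \<partial>\<beta>)"
    unfolding eP by (intro nn_integral_mono body_gauge_le_Lip)
  also have "\<dots> = expected_gauge Q K + Lip K * D"
    unfolding eQ D_def by (simp add: nn_integral_add nn_integral_cmult)
  finally show "expected_gauge P K \<le> expected_gauge Q K + Lip K * D" .
  have "expected_gauge Q K \<le> (\<integral>\<^sup>+ z. ennreal (body_gauge K (fst z)) 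
      + Lip K * ennreal (norm (fst z - snd z)) \<partial>\<beta>)"
    unfolding eQ by (intro nn_integral_mono) (metis body_gauge_le_Lip norm_minus_commute)
  also have "\<dots> = expected_gauge P K + Lip K * D"
    unfolding eP D_def by (simp add: nn_integral_add nn_integral_cmult)
  finally show "expected_gauge Q K \<le> expected_gauge P K + Lip K * D" .
qed

text \<open>The independent coupling shows that \<open>W1\<close> is an infimum over a nonempty set,
  as \<open>ennreal_le_mult_INF\<close> requires when the factor is 0.\<close>

lemma pair_measure_in_couplings:
  assumes "prob_space P" "prob_space Q"
  shows "P \<Otimes>\<^sub>M Q \<in> couplings P Q"
proof -
  interpret P: prob_space P by fact
  interpret Q: prob_space Q by fact
  have "distr (P \<Otimes>\<^sub>M Q) Q snd = Q"
  proof (rule measure_eqI)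
    fix A assume "A \<in> sets (distr (P \<Otimes>\<^sub>M Q) Q snd)"
    then have A: "A \<in> sets Q" by simp
    then have "snd -` A \<inter> space (P \<Otimes>\<^sub>M Q) = space P \<times> A"
      by (auto simp: space_pair_measure dest: sets.sets_into_space)
    with A show "emeasure (distr (P \<Otimes>\<^sub>M Q) Q snd) A = emeasure Q A"
      by (simp add: emeasure_distr Q.emeasure_pair_measure_Times P.emeasure_space_1)
  qed simp
  then show ?thesis
    by (simp add: couplings_def Q.distr_pair_fst prob_space_pair assms)
qed

theorem proposition4p2:
  fixes P Q :: "(real ^ 'd) measure" and K\<^sub>P K\<^sub>Q :: "(real ^ 'd) set"
  assumes "prob_space P" and "sets P = sets borel"
    and "prob_space Q" and "sets Q = sets borel"
    and "is_arg_min (expected_gauge P) unit_volume_convex_body K\<^sub>P"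
    and "is_arg_min (expected_gauge Q) unit_volume_convex_body K\<^sub>Q"
  shows "expected_gauge Q K\<^sub>P
           \<le> (INF K\<in>{K. unit_volume_convex_body K}. expected_gauge Q K)
              + (Lip K\<^sub>P + Lip K\<^sub>Q) * W1 P Q"
proof -
  let ?D = "\<lambda>\<beta>. \<integral>\<^sup>+ z. ennreal (norm (fst z - snd z)) \<partial>\<beta>"
  let ?L = "Lip K\<^sub>P + Lip K\<^sub>Q"
  have bodies: "unit_volume_convex_body K\<^sub>P" "unit_volume_convex_body K\<^sub>Q"
    using assms(5,6) by (auto simp: is_arg_min_linorder)
  have L: "Lip K\<^sub>P < \<top>" "Lip K\<^sub>Q < \<top>"
    using bodies by (auto simp: unit_volume_convex_body_def intro: Lip_convex_star_body_finite)
  have optP: "expected_gauge P K\<^sub>P \<le> expected_gauge P K\<^sub>Q"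
    using assms(5) bodies by (simp add: is_arg_min_linorder)
  have optQ: "expected_gauge Q K\<^sub>Q \<le> (INF K\<in>{K. unit_volume_convex_body K}. expected_gauge Q K)"
    using assms(6) by (intro INF_greatest) (simp add: is_arg_min_linorder)
  have bound: "expected_gauge Q K\<^sub>P \<le> expected_gauge Q K\<^sub>Q + ?L * ?D \<beta>"
    if \<beta>: "\<beta> \<in> couplings P Q" for \<beta>
  proof -
    note le = expected_gauge_le_coupling[OF assms(2,4) \<beta>]
    have "expected_gauge Q K\<^sub>P \<le> expected_gauge P K\<^sub>P + Lip K\<^sub>P * ?D \<beta>"
      by (rule le(2)[OF L(1)])
    also have "\<dots> \<le> expected_gauge P K\<^sub>Q + Lip K\<^sub>P * ?D \<beta>"
      by (intro add_right_mono optP)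
    also have "\<dots> \<le> (expected_gauge Q K\<^sub>Q + Lip K\<^sub>Q * ?D \<beta>) + Lip K\<^sub>P * ?D \<beta>"
      by (intro add_right_mono le(1)[OF L(2)])
    finally show ?thesis by (simp add: distrib_right add_ac)
  qed
  have ne: "couplings P Q \<noteq> {}"
    using pair_measure_in_couplings[OF assms(1,3)] by blast
  have "expected_gauge Q K\<^sub>P \<le> expected_gauge Q K\<^sub>Q + ?L * W1 P Q"
  \<comment> \<open>Subtracting the expectation isolates the product with the coupling cost, so that
    the infimum can be taken; this needs a finite value. If it is infinite, so is the right-hand
    side.\<close>
  proof (cases "expected_gauge Q K\<^sub>Q = \<top>")
    case False
    have "expected_gauge Q K\<^sub>P - expected_gauge Q K\<^sub>Q \<le> ?L * W1 P Q"
      unfolding W1_def using bound L ne False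
      by (intro ennreal_le_mult_INF) (auto simp: ennreal_minus_le_iff)
    with False show ?thesis by (simp add: ennreal_minus_le_iff)
  qed simp
  also have "\<dots> \<le> (INF K\<in>{K. unit_volume_convex_body K}. expected_gauge Q K) + ?L * W1 P Q"
    by (intro add_right_mono optQ)
  finally show ?thesis .
qed

end
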